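(* Let $\alpha>0$ and let $\nu\in\mathcal{P}_+$ with $\nu\neq\delta_0$. Let $\{N(t):t\ge0\}$ be the renewal process for the Kendall convolution $\vartriangle_\alpha$ with unit step distribution $\nu$. Then for every $t>0$ the renewal function is $$R(t):=\mathbf{E}N(t)=\frac{G(t)}{\overline{G}(t)}+\frac{H(t)}{t^{\alpha}\,\overline{G}(t)^2}.$$ Moreover $$\mathbf{E}N^2(t)=\frac{t^{-\alpha}H(t)\bigl(1+3G(t)\bigr)+G(t)\bigl(1-G^2(t)\bigr)}{\overline{G}(t)^3}$$ and $$\mathrm{Var}(N(t))=\frac{H(t)\bigl(1+G(t)\bigr)}{t^{\alpha}\,\overline{G}(t)^3}+\frac{G(t)}{\overline{G}(t)^2}-\frac{H^2(t)}{t^{2\alpha}\,\overline{G}(t)^4}.$$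
   Context: $\mathcal{P}_+$ is the set of Borel probability measures on $[0,\infty)$. For $\alpha>0$ the Kendall convolution $\vartriangle_\alpha$ is the commutative, associative operation on $\mathcal{P}_+$ given by $\delta_x\vartriangle_\alpha\delta_1=(1-x^\alpha)\delta_1+x^\alpha\pi_{2\alpha}$ for $x\in[0,1]$, where $\pi_{2\alpha}(dy)=2\alpha y^{-2\alpha-1}\mathbf{1}_{[1,\infty)}(y)\,dy$; by scaling, for $0\le x\le y$, $y>0$, $\delta_x\vartriangle_\alpha\delta_y$ is the law of $yX$ where $X$ has law $\delta_{x/y}\vartriangle_\alpha\delta_1$; $\delta_0\vartriangle_\alpha\delta_0=\delta_0$; and $(\lambda_1\vartriangle_\alpha\lambda_2)(A)=\int\int(\delta_x\vartriangle_\alpha\delta_y)(A)\,\lambda_1(dx)\lambda_2(dy)$. $\nu^{\vartriangle_\alpha n}$ is the $n$-fold convolution power. The Kendall random walk with step distribution $\nu$ is the Markov process $(S_n)_{n\ge1}$ with $\mathcal{L}(S_1)=\nu$ and $P(S_n\in\cdot\mid S_k=x)=\delta_x\vartriangle_\alpha\nu^{\vartriangle_\alpha(n-k)}$ for $k<n$. The renewal process is $N(t)=\inf\{n\ge0:S_{n+1}>t\}$ ($=\infty$ if no such $n$ exists). For $t>0$: $G(t)=\int_{[0,\infty)}(1-x^\alpha/t^\alpha)_+\,\nu(dx)$, $\overline{G}(t)=1-G(t)$, $H(t)=\int_{[0,t]}x^\alpha\,\nu(dx)$, where $a_+=\max\{a,0\}$. *)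

theory Defs
  imports "HOL-Probability.Probability"
begin

definition half_line_distributions :: "real measure set" where
  "half_line_distributions = {\<nu>. real_distribution \<nu> \<and> emeasure \<nu> {..<0} = 0}"

definition kendall_pareto :: "real \<Rightarrow> real measure" where
  "kendall_pareto \<alpha> =
     density lborel (\<lambda>y. ennreal (2 * \<alpha> * y powr (- 2 * \<alpha> - 1)) * indicator {1..} y)"

definition kendall_unit :: "real \<Rightarrow> real \<Rightarrow> real measure" where
  "kendall_unit \<alpha> x = measure_of UNIV (sets borel)
     (\<lambda>A. ennreal (1 - x powr \<alpha>) * emeasure (return borel 1) A
        + ennreal (x powr \<alpha>) * emeasure (kendall_pareto \<alpha>) A)"

(* The Kendall convolution of the point masses at x and y.  Outside the quadrant x, y \<ge> 0
   the value is irrelevant; it is chosen so that the map is a Markov kernel on all of R x R,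
   as the Giry monad requires. *)
definition kendall_kernel :: "real \<Rightarrow> real \<Rightarrow> real \<Rightarrow> real measure" where
  "kendall_kernel \<alpha> x y =
     (if 0 \<le> x \<and> 0 \<le> y \<and> 0 < max x y
      then distr (kendall_unit \<alpha> (min x y / max x y)) borel (\<lambda>z. max x y * z)
      else return borel 0)"

definition kendall_conv :: "real \<Rightarrow> real measure \<Rightarrow> real measure \<Rightarrow> real measure" where
  "kendall_conv \<alpha> \<mu> \<nu> = \<mu> \<bind> (\<lambda>x. \<nu> \<bind> (\<lambda>y. kendall_kernel \<alpha> x y))"

(* The unit mass at 0 is the neutral element of the convolution. *)
primrec kendall_power :: "real \<Rightarrow> real measure \<Rightarrow> nat \<Rightarrow> real measure" where
  "kendall_power \<alpha> \<nu> 0 = return borel 0"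
| "kendall_power \<alpha> \<nu> (Suc n) = kendall_conv \<alpha> (kendall_power \<alpha> \<nu> n) \<nu>"

definition natural_history :: "'a measure \<Rightarrow> (nat \<Rightarrow> 'a \<Rightarrow> real) \<Rightarrow> nat \<Rightarrow> 'a measure" where
  "natural_history M S k =
     sigma (space M) (\<Union>i\<in>{1..k}. {S i -` A \<inter> space M | A. A \<in> sets borel})"

(* The walk is indexed by n \<ge> 1; S 0 is not constrained.  The last conjunct combines the Markov
   property with the transition probabilities: conditioning is on the whole past up to time k. *)
definition kendall_random_walk ::
    "real \<Rightarrow> real measure \<Rightarrow> 'a measure \<Rightarrow> (nat \<Rightarrow> 'a \<Rightarrow> real) \<Rightarrow> bool" where
  "kendall_random_walk \<alpha> \<nu> M S \<longleftrightarrow>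
     prob_space M \<and>
     (\<forall>n\<ge>1. S n \<in> borel_measurable M \<and> (\<forall>\<omega>\<in>space M. 0 \<le> S n \<omega>)) \<and>
     distr M borel (S 1) = \<nu> \<and>
     (\<forall>k n A. 1 \<le> k \<longrightarrow> k < n \<longrightarrow> A \<in> sets borel \<longrightarrow>
        (AE \<omega> in M. real_cond_exp M (natural_history M S k) (indicator (S n -` A \<inter> space M)) \<omega>
           = measure (kendall_conv \<alpha> (return borel (S k \<omega>)) (kendall_power \<alpha> \<nu> (n - k))) A))"

(* The infimum of the empty set in enat is \<infinity>. *)
definition renewal_process :: "(nat \<Rightarrow> 'a \<Rightarrow> real) \<Rightarrow> real \<Rightarrow> 'a \<Rightarrow> enat" where
  "renewal_process S t \<omega> = Inf {enat n | n. S (Suc n) \<omega> > t}"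

definition renewal_function :: "'a measure \<Rightarrow> (nat \<Rightarrow> 'a \<Rightarrow> real) \<Rightarrow> real \<Rightarrow> ereal" where
  "renewal_function M S t =
     enn2ereal (\<integral>\<^sup>+\<omega>. ennreal_of_enat (renewal_process S t \<omega>) \<partial>M)"

definition renewal_second_moment :: "'a measure \<Rightarrow> (nat \<Rightarrow> 'a \<Rightarrow> real) \<Rightarrow> real \<Rightarrow> ereal" where
  "renewal_second_moment M S t =
     enn2ereal (\<integral>\<^sup>+\<omega>. (ennreal_of_enat (renewal_process S t \<omega>))\<^sup>2 \<partial>M)"

(* enn2real sends \<infinity> to 0.  This is the usual variance as soon as the second moment above is
   finite, which also makes the renewal process finite almost everywhere. *)
definition renewal_variance :: "'a measure \<Rightarrow> (nat \<Rightarrow> 'a \<Rightarrow> real) \<Rightarrow> real \<Rightarrow> real" where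
  "renewal_variance M S t =
     prob_space.variance M (\<lambda>\<omega>. enn2real (ennreal_of_enat (renewal_process S t \<omega>)))"

definition kendall_G :: "real \<Rightarrow> real measure \<Rightarrow> real \<Rightarrow> real" where
  "kendall_G \<alpha> \<nu> t = (LINT x:{0..}|\<nu>. max (1 - x powr \<alpha> / t powr \<alpha>) 0)"

definition kendall_G_bar :: "real \<Rightarrow> real measure \<Rightarrow> real \<Rightarrow> real" where
  "kendall_G_bar \<alpha> \<nu> t = 1 - kendall_G \<alpha> \<nu> t"

definition kendall_H :: "real \<Rightarrow> real measure \<Rightarrow> real \<Rightarrow> real" where
  "kendall_H \<alpha> \<nu> t = (LINT x:{0..t}|\<nu>. x powr \<alpha>)"

lemma sets_kendall_pareto [simp, measurable_cong]: "sets (kendall_pareto \<alpha>) = sets borel"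
  by (simp add: kendall_pareto_def)

lemma emeasure_kendall_pareto_UNIV:
  assumes "\<alpha> > 0"
  shows "emeasure (kendall_pareto \<alpha>) UNIV = 1"
proof -
  have lim: "((\<lambda>y. - (y powr (- 2 * \<alpha>))) \<longlongrightarrow> - 0) at_top"
    using assms by (intro tendsto_minus tendsto_neg_powr filterlim_ident) auto
  have "emeasure (kendall_pareto \<alpha>) UNIV
      = (\<integral>\<^sup>+y. ennreal (2 * \<alpha> * y powr (- 2 * \<alpha> - 1)) * indicator {1..} y \<partial>lborel)"
    by (simp add: kendall_pareto_def emeasure_density)
  also have "\<dots> = ennreal (- 0 - (- (1 powr (- 2 * \<alpha>))))"
    using assms by (intro nn_integral_FTC_atLeast[OF _ _ _ lim]) (auto intro!: derivative_eq_intros)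
  finally show ?thesis by simp
qed

lemma
  shows sets_kendall_unit [simp, measurable_cong]: "sets (kendall_unit \<alpha> x) = sets borel"
    and space_kendall_unit [simp]: "space (kendall_unit \<alpha> x) = UNIV"
proof -
  have "sigma_sets UNIV (sets (borel :: real measure)) = sets borel"
    using sets.sigma_sets_eq[of "borel :: real measure"] by simp
  then show "sets (kendall_unit \<alpha> x) = sets borel"
    by (simp add: kendall_unit_def)
  show "space (kendall_unit \<alpha> x) = UNIV"
    by (simp add: kendall_unit_def)
qed

lemma emeasure_kendall_unit:
  assumes "A \<in> sets borel"
  shows "emeasure (kendall_unit \<alpha> x) A =
     ennreal (1 - x powr \<alpha>) * indicator A 1 + ennreal (x powr \<alpha>) * emeasure (kendall_pareto \<alpha>) A"
proof -
  let ?\<mu> = "\<lambda>A. ennreal (1 - x powr \<alpha>) * emeasure (return borel 1) A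
        + ennreal (x powr \<alpha>) * emeasure (kendall_pareto \<alpha>) A"
  have "countably_additive (sets (borel :: real measure)) ?\<mu>"
  proof (rule countably_additiveI)
    fix B :: "nat \<Rightarrow> real set"
    assume B: "range B \<subseteq> sets borel" "disjoint_family B" "(\<Union>i. B i) \<in> sets borel"
    have "(\<Sum>i. emeasure (return borel 1) (B i)) = emeasure (return borel 1) (\<Union>i. B i)"
      "(\<Sum>i. emeasure (kendall_pareto \<alpha>) (B i)) = emeasure (kendall_pareto \<alpha>) (\<Union>i. B i)"
      using B by (intro suminf_emeasure; simp)+
    then show "(\<Sum>i. ?\<mu> (B i)) = ?\<mu> (\<Union>i. B i)"
      by (simp only: suminf_add[OF summableI summableI, symmetric] ennreal_suminf_cmult)
  qed
  moreover have "sigma_algebra UNIV (sets (borel :: real measure))"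
    using sets.sigma_algebra_axioms[of "borel :: real measure"] by simp
  ultimately have "emeasure (kendall_unit \<alpha> x) A = ?\<mu> A"
    unfolding kendall_unit_def using assms
    by (intro emeasure_measure_of_sigma) (auto simp: positive_def)
  then show ?thesis
    using assms by simp
qed

lemma prob_space_kendall_unit:
  assumes "\<alpha> > 0" "0 \<le> x" "x \<le> 1"
  shows "prob_space (kendall_unit \<alpha> x)"
proof
  have "x powr \<alpha> \<le> 1"
    using assms powr_mono2[of \<alpha> x 1] by simp
  then show "emeasure (kendall_unit \<alpha> x) (space (kendall_unit \<alpha> x)) = 1"
    using assms(1)
    by (simp add: emeasure_kendall_unit emeasure_kendall_pareto_UNIV flip: ennreal_plus)
qed

lemma kendall_kernel_commute: "kendall_kernel \<alpha> x y = kendall_kernel \<alpha> y x"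
  by (auto simp: kendall_kernel_def max.commute min.commute)

lemma kendall_kernel_0_left:
  assumes "\<alpha> > 0" "0 \<le> y"
  shows "kendall_kernel \<alpha> 0 y = return borel y"
proof (cases "y = 0")
  case False
  then have "kendall_kernel \<alpha> 0 y = distr (kendall_unit \<alpha> 0) borel (\<lambda>z. y * z)"
    using assms by (simp add: kendall_kernel_def)
  also have "\<dots> = return borel y"
  proof (rule measure_eqI)
    fix A assume "A \<in> sets (distr (kendall_unit \<alpha> 0) borel (\<lambda>z. y * z))"
    then have A [measurable]: "A \<in> sets borel" by simp
    have "(\<lambda>z. y * z) -` A \<in> sets borel"
      by (rule measurable_sets_borel[OF _ A]) simp
    then show "emeasure (distr (kendall_unit \<alpha> 0) borel (\<lambda>z. y * z)) A = emeasure (return borel y) A"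
      by (simp add: emeasure_distr emeasure_kendall_unit indicator_def)
  qed simp
  finally show ?thesis .
qed (simp add: kendall_kernel_def)

lemma measurable_kendall_kernel [measurable]:
  assumes "\<alpha> > 0"
  shows "(\<lambda>(x, y). kendall_kernel \<alpha> x y) \<in> borel \<Otimes>\<^sub>M borel \<rightarrow>\<^sub>M prob_algebra borel"
proof -
  define U where "U = (\<lambda>p. kendall_unit \<alpha> (if 0 \<le> fst p \<and> 0 \<le> snd p
      then min (fst p) (snd p) / max (fst p) (snd p) else 0))"
  have [measurable]: "U \<in> borel \<Otimes>\<^sub>M borel \<rightarrow>\<^sub>M prob_algebra borel"
  proof -
    have prob: "prob_space (U p)" for p
      unfolding U_def using assms
      by (intro prob_space_kendall_unit) (auto simp: divide_le_eq_1 min_def max_def)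
    show ?thesis
    proof (rule measurable_prob_algebraI[OF prob], rule measurable_subprob_algebra)
      show "subprob_space (U p)" for p
        using prob by (rule prob_space_imp_subprob_space)
      show "sets (U p) = sets borel" for p
        by (simp add: U_def)
      show "(\<lambda>p. emeasure (U p) A) \<in> borel_measurable (borel \<Otimes>\<^sub>M borel)" if "A \<in> sets borel" for A
        using that unfolding U_def by (simp add: emeasure_kendall_unit)
    qed
  qed
  have "(\<lambda>p. if 0 \<le> fst p \<and> 0 \<le> snd p \<and> 0 < max (fst p) (snd p)
      then distr (U p) borel (\<lambda>z. max (fst p) (snd p) * z) else return borel 0)
      \<in> borel \<Otimes>\<^sub>M borel \<rightarrow>\<^sub>M prob_algebra borel"
    by measurable
  also have "?this \<longleftrightarrow> ?thesis"
    by (intro measurable_cong) (auto simp: kendall_kernel_def U_def)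
  finally show ?thesis .
qed

lemma measurable_kendall_kernel2 [measurable]:
  assumes "\<alpha> > 0" "f \<in> M \<rightarrow>\<^sub>M borel" "g \<in> M \<rightarrow>\<^sub>M borel"
  shows "(\<lambda>z. kendall_kernel \<alpha> (f z) (g z)) \<in> M \<rightarrow>\<^sub>M prob_algebra borel"
  using measurable_compose[OF measurable_Pair[OF assms(2,3)] measurable_kendall_kernel[OF assms(1)]]
  by simp

lemma measurable_kendall_conv_kernel:
  assumes "\<alpha> > 0" "real_distribution \<nu>"
  shows "(\<lambda>x. \<nu> \<bind> (\<lambda>y. kendall_kernel \<alpha> x y)) \<in> borel \<rightarrow>\<^sub>M prob_algebra borel"
proof (rule measurable_bind_prob_space2)
  show "(\<lambda>x. \<nu>) \<in> borel \<rightarrow>\<^sub>M prob_algebra borel"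
    using assms(2) by (auto simp: space_prob_algebra real_distribution_def real_distribution_axioms_def)
qed (use measurable_kendall_kernel[OF assms(1)] in simp)

lemma emeasure_kendall_conv:
  assumes "\<alpha> > 0" "real_distribution \<mu>" "real_distribution \<nu>" "A \<in> sets borel"
  shows "emeasure (kendall_conv \<alpha> \<mu> \<nu>) A
    = (\<integral>\<^sup>+x. \<integral>\<^sup>+y. emeasure (kendall_kernel \<alpha> x y) A \<partial>\<nu> \<partial>\<mu>)"
proof -
  have sp: "\<mu> \<in> space (prob_algebra borel)" "\<nu> \<in> space (prob_algebra borel)"
    using assms(2,3)
    by (auto simp: space_prob_algebra real_distribution_def real_distribution_axioms_def)
  have "emeasure (kendall_conv \<alpha> \<mu> \<nu>) A
      = (\<integral>\<^sup>+x. emeasure (\<nu> \<bind> (\<lambda>y. kendall_kernel \<alpha> x y)) A \<partial>\<mu>)"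
    unfolding kendall_conv_def
    by (rule emeasure_bind_prob_algebra[OF sp(1) measurable_kendall_conv_kernel[OF assms(1,3)] assms(4)])
  also have "\<dots> = (\<integral>\<^sup>+x. \<integral>\<^sup>+y. emeasure (kendall_kernel \<alpha> x y) A \<partial>\<nu> \<partial>\<mu>)"
    using assms(1) by (intro nn_integral_cong emeasure_bind_prob_algebra[OF sp(2) _ assms(4)]) simp
  finally show ?thesis .
qed

lemma real_distribution_kendall_conv:
  assumes "\<alpha> > 0" "real_distribution \<mu>" "real_distribution \<nu>"
  shows "real_distribution (kendall_conv \<alpha> \<mu> \<nu>)"
proof -
  have "\<mu> \<in> space (prob_algebra borel)"
    using assms(2) by (auto simp: space_prob_algebra real_distribution_def real_distribution_axioms_def)
  then show ?thesis
    unfolding kendall_conv_def real_distribution_def real_distribution_axioms_def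
    using prob_space_bind'[OF _ measurable_kendall_conv_kernel[OF assms(1,3)]]
      sets_bind'[OF _ measurable_kendall_conv_kernel[OF assms(1,3)]] by simp
qed

end

(* On point masses the Williamson transform W(x) = (1 - x^\<alpha> / t^\<alpha>)_+ satisfies
   \<integral> W d(\<delta>_x * \<delta>_y) = W(x) W(y), so that \<integral> W d\<mu>_n = G(t)^n for the law \<mu>_n of S_n.  The distribution
   functions F_n = \<mu>_n [0,t] obey F_(n+1) = F_n G(t) + G(t)^n h with h = H(t) / t^\<alpha>, whence
   F_n = G(t)^n + n G(t)^(n-1) h.  Almost surely the walk does not return below t once it has
   exceeded t, so P(N(t) \<ge> n) = F_n, and the moments are sums of differentiated geometric series. *)
theory Submission
  imports Defs
begin

text \<open>The distribution function alone does not close under convolution: for x, y \<le> t the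
  kernel gives [0,t] the mass \<open>1 - u v\<close>, where u and v are the scaled powers of x and
  y, and this is not a product of a function of x and a function of y. It is a sum of two such
  products, one of which contains W(x), so the pair (distribution function, Williamson transform)
  does close. The transform has a linear recursion of its own, and its n-th power is the forcing
  term that produces the factor n in F_n. The exponent 2\<alpha> of the Pareto law is what makes the
  transform multiplicative: at the equal arguments x = y the kernel is a scaled Pareto law, and its
  transform has to be the square of W(y). The absence of returns replaces the joint law of the first
  n positions by the law of the last one, so one-step transitions suffice. Integrals are taken in
  \<open>ennreal\<close>, where sums and integrals commute for nonnegative terms and an infinite
  N(t) is a legitimate value. That \<nu> is not the unit mass at 0 enters through G(t) < 1, which
  makes the series converge.\<close>

definition williamson :: "real \<Rightarrow> real \<Rightarrow> real \<Rightarrow> real" where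
  "williamson \<alpha> t x = max (1 - x powr \<alpha> / t powr \<alpha>) 0"

lemma borel_measurable_williamson [measurable]: "williamson \<alpha> t \<in> borel_measurable borel"
  unfolding williamson_def by measurable

lemma williamson_nonneg: "0 \<le> williamson \<alpha> t x"
  and williamson_le_1: "williamson \<alpha> t x \<le> 1"
  by (simp_all add: williamson_def)

section \<open>Integration against the Pareto law, the unit kernel and the scaled kernel\<close>

lemma AE_kendall_pareto: "AE z in kendall_pareto \<alpha>. 1 \<le> z"
  unfolding kendall_pareto_def by (subst AE_density) (auto simp: indicator_def)

text \<open>\<open>kendall_unit\<close> is built by \<open>measure_of\<close> from a set function,
  so what is known is its value on sets. Both sides are additive, homogeneous and continuous along
  increasing sequences, which carries the formula from indicators to every measurable
  \<open>f\<close>.\<close>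

lemma nn_integral_kendall_unit:
  assumes "f \<in> borel_measurable borel"
  shows "(\<integral>\<^sup>+z. f z \<partial>kendall_unit \<alpha> x)
    = ennreal (1 - x powr \<alpha>) * f 1 + ennreal (x powr \<alpha>) * (\<integral>\<^sup>+z. f z \<partial>kendall_pareto \<alpha>)"
  using assms
proof (induction rule: borel_measurable_induct)
  case (cong f g)
  then have "f = g" by (auto simp: fun_eq_iff)
  with cong show ?case by simp
next
  case (set A)
  then show ?case by (simp add: emeasure_kendall_unit)
next
  case (mult u c)
  then show ?case by (simp add: nn_integral_cmult algebra_simps)
next
  case (add u v)
  then show ?case by (simp add: nn_integral_add algebra_simps)
next
  case (seq U)
  note [measurable] = seq(1)
  have IH: "(\<integral>\<^sup>+z. U i z \<partial>kendall_unit \<alpha> x) = ennreal (1 - x powr \<alpha>) * U i 1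
      + ennreal (x powr \<alpha>) * (\<integral>\<^sup>+z. U i z \<partial>kendall_pareto \<alpha>)" for i
    by fact
  \<comment> \<open>Both summands increase with \<open>i\<close>, which is what lets the supremum of
    their sum split.\<close>
  have inc: "incseq (\<lambda>i. ennreal (1 - x powr \<alpha>) * U i 1)"
    "incseq (\<lambda>i. ennreal (x powr \<alpha>) * (\<integral>\<^sup>+z. U i z \<partial>kendall_pareto \<alpha>))"
    by (intro monoI mult_left_mono nn_integral_mono le_funD[OF monoD[OF \<open>incseq U\<close>]]; simp)+
  have "(\<integral>\<^sup>+z. (SUP i. U i) z \<partial>kendall_unit \<alpha> x) = (SUP i. \<integral>\<^sup>+z. U i z \<partial>kendall_unit \<alpha> x)"
    unfolding SUP_apply by (intro nn_integral_monotone_convergence_SUP \<open>incseq U\<close>) simp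
  also have "\<dots> = (SUP i. ennreal (1 - x powr \<alpha>) * U i 1)
      + (SUP i. ennreal (x powr \<alpha>) * (\<integral>\<^sup>+z. U i z \<partial>kendall_pareto \<alpha>))"
    unfolding IH by (intro ennreal_SUP_add inc)
  also have "\<dots> = ennreal (1 - x powr \<alpha>) * (SUP i. U i) 1
      + ennreal (x powr \<alpha>) * (SUP i. \<integral>\<^sup>+z. U i z \<partial>kendall_pareto \<alpha>)"
    by (simp add: SUP_mult_left_ennreal image_comp)
  also have "(SUP i. \<integral>\<^sup>+z. U i z \<partial>kendall_pareto \<alpha>) = (\<integral>\<^sup>+z. (SUP i. U i) z \<partial>kendall_pareto \<alpha>)"
    unfolding SUP_apply by (intro nn_integral_monotone_convergence_SUP[symmetric] \<open>incseq U\<close>) simp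
  finally show ?case .
qed

lemma nn_integral_kendall_kernel:
  assumes "f \<in> borel_measurable borel" "0 \<le> x" "x \<le> y" "0 < y"
  shows "(\<integral>\<^sup>+z. f z \<partial>kendall_kernel \<alpha> x y)
    = ennreal (1 - (x / y) powr \<alpha>) * f y
      + ennreal ((x / y) powr \<alpha>) * (\<integral>\<^sup>+z. f (y * z) \<partial>kendall_pareto \<alpha>)"
proof -
  note [measurable] = assms(1)
  have "kendall_kernel \<alpha> x y = distr (kendall_unit \<alpha> (x / y)) borel (\<lambda>z. y * z)"
    using assms by (simp add: kendall_kernel_def max_def min_def)
  then show ?thesis
    by (simp add: nn_integral_distr nn_integral_kendall_unit)
qed

section \<open>Williamson transform and distribution function of the kernel\<close>

lemma emeasure_kendall_pareto_atMost:
  assumes "\<alpha> > 0" "1 \<le> T"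
  shows "emeasure (kendall_pareto \<alpha>) {..T} = ennreal (1 - T powr (- 2 * \<alpha>))"
proof -
  have "emeasure (kendall_pareto \<alpha>) {..T}
      = (\<integral>\<^sup>+y. ennreal (2 * \<alpha> * y powr (- 2 * \<alpha> - 1)) * indicator {1..T} y \<partial>lborel)"
    by (auto simp: kendall_pareto_def emeasure_density indicator_def intro!: nn_integral_cong)
  also have "\<dots> = ennreal (- (T powr (- 2 * \<alpha>)) - (- (1 powr (- 2 * \<alpha>))))"
    using assms
    by (intro nn_integral_FTC_Icc) (auto intro!: derivative_eq_intros)
  finally show ?thesis by simp
qed

text \<open>The Pareto law scaled by \<open>y\<close> is the convolution of two unit masses at
  \<open>y\<close>, so its transform should be the square of that of one unit mass.\<close>

lemma nn_integral_williamson_kendall_pareto: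
  assumes "\<alpha> > 0" "0 < y" "y \<le> t"
  shows "(\<integral>\<^sup>+z. ennreal (williamson \<alpha> t (y * z)) \<partial>kendall_pareto \<alpha>)
    = ennreal ((1 - y powr \<alpha> / t powr \<alpha>)\<^sup>2)"
proof -
  define w where "w = y powr \<alpha> / t powr \<alpha>"
  \<comment> \<open>\<open>T\<close> is the point at which \<open>y * z\<close> reaches
    \<open>t\<close>. The integrand vanishes beyond it, and \<open>w * T powr \<alpha> = 1\<close>
    turns the boundary terms into powers of \<open>w\<close>.\<close>
  define T where "T = t / y"
  have T: "1 \<le> T" using assms by (simp add: T_def)
  have wT: "w * T powr \<alpha> = 1" using assms by (simp add: w_def T_def powr_divide)
  have eq: "williamson \<alpha> t (y * z) = (if z \<le> T then 1 - w * z powr \<alpha> else 0)" if "1 \<le> z" for z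
  proof -
    have "z powr \<alpha> \<le> T powr \<alpha> \<longleftrightarrow> z \<le> T"
      using that T assms powr_mono2[of \<alpha> z T] powr_less_mono2[of \<alpha> T z] by linarith
    moreover have "w * z powr \<alpha> \<le> 1 \<longleftrightarrow> z powr \<alpha> \<le> T powr \<alpha>"
    proof -
      have "0 < w" using assms by (simp add: w_def)
      then show ?thesis using wT mult_le_cancel_left_pos[of w "z powr \<alpha>" "T powr \<alpha>"] by simp
    qed
    ultimately show ?thesis
      using assms that by (auto simp: williamson_def w_def powr_mult max_def)
  qed
  have "(\<integral>\<^sup>+z. ennreal (williamson \<alpha> t (y * z)) \<partial>kendall_pareto \<alpha>)
      = (\<integral>\<^sup>+z. ennreal (2 * \<alpha> * z powr (- 2 * \<alpha> - 1) * (1 - w * z powr \<alpha>)) * indicator {1..T} z \<partial>lborel)"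
    using assms(1) unfolding kendall_pareto_def
    by (subst nn_integral_density)
       (auto simp: indicator_def eq ennreal_mult' intro!: nn_integral_cong)
  \<comment> \<open>The antiderivative takes the value \<open>- w^2 + 2 * w * w = w^2\<close> at
    \<open>T\<close> and \<open>2 * w - 1\<close> at 1; the difference is
    \<open>(1 - w)^2\<close>.\<close>
  also have "\<dots> = ennreal ((- (T powr (- 2 * \<alpha>)) + 2 * w * T powr (- \<alpha>))
      - (- (1 powr (- 2 * \<alpha>)) + 2 * w * 1 powr (- \<alpha>)))"
  proof (rule nn_integral_FTC_Icc)
    fix z :: real assume "z \<in> {1..T}"
    then have z: "1 \<le> z" "z \<le> T" by auto
    then show "((\<lambda>z. - (z powr (- 2 * \<alpha>)) + 2 * w * z powr (- \<alpha>)) has_real_derivative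
        2 * \<alpha> * z powr (- 2 * \<alpha> - 1) * (1 - w * z powr \<alpha>)) (at z)"
      by (auto intro!: derivative_eq_intros simp: algebra_simps powr_add[symmetric])
    show "0 \<le> 2 * \<alpha> * z powr (- 2 * \<alpha> - 1) * (1 - w * z powr \<alpha>)"
      using z eq[of z] assms(1) by (auto simp: williamson_def max_def split: if_splits)
  qed (use T in auto)
  also have "T powr (- \<alpha>) = w"
    using wT T by (simp add: powr_minus field_simps)
  also have "T powr (- 2 * \<alpha>) = w\<^sup>2"
  proof -
    have "T powr (- 2 * \<alpha>) = (T powr (- \<alpha>)) * (T powr (- \<alpha>))"
      by (simp flip: powr_add)
    then show ?thesis by (simp add: \<open>T powr (- \<alpha>) = w\<close> power2_eq_square)
  qed
  finally show ?thesis
    by (simp add: w_def[symmetric] power2_eq_square algebra_simps)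
qed

lemma less_powr_divide:
  fixes x t \<alpha> :: real
  assumes "\<alpha> > 0" "0 < t" "t < x"
  shows "1 < x powr \<alpha> / t powr \<alpha>"
  using assms by (simp add: powr_less_mono2)

lemma powr_divide_le_1:
  fixes x t \<alpha> :: real
  assumes "\<alpha> > 0" "0 \<le> x" "x \<le> t"
  shows "x powr \<alpha> / t powr \<alpha> \<le> 1"
  using assms powr_mono2[of \<alpha> x t] by (simp add: divide_le_eq_1)

text \<open>By symmetry let x \<le> y. For 0 < y \<le> t the kernel mixes the transforms
  \<open>1 - w\<close> and \<open>(1 - w)^2\<close> with weights \<open>1 - \<rho>\<close> and
  \<open>\<rho>\<close>, and the mixture factors as \<open>(1 - \<rho> * w) * (1 - w)\<close>. Since
  \<open>\<rho> * w\<close> is the scaled power of \<open>x\<close>, this is the required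
  product.\<close>

lemma nn_integral_williamson_kendall_kernel:
  assumes "\<alpha> > 0" "t > 0" "0 \<le> x" "0 \<le> y"
  shows "(\<integral>\<^sup>+z. ennreal (williamson \<alpha> t z) \<partial>kendall_kernel \<alpha> x y)
    = ennreal (williamson \<alpha> t x) * ennreal (williamson \<alpha> t y)"
  using assms(3,4)
proof (induction x y rule: linorder_wlog)
  case (sym x y)
  then show ?case by (simp add: kendall_kernel_commute mult.commute)
next
  case (le x y)
  show ?case
  proof (cases "y = 0")
    case True
    with le show ?thesis
      by (simp add: kendall_kernel_def nn_integral_return williamson_def)
  next
    case False
    with le have y: "y > 0" by simp
    define \<rho> where "\<rho> = (x / y) powr \<alpha>"
    define w where "w = y powr \<alpha> / t powr \<alpha>"
    have \<rho>: "0 \<le> \<rho>" "\<rho> \<le> 1"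
      using powr_divide_le_1[of \<alpha> x y] le assms by (auto simp: \<rho>_def powr_divide)
    have u: "x powr \<alpha> / t powr \<alpha> = \<rho> * w"
      using y le by (simp add: \<rho>_def w_def powr_divide)
    note 1 = nn_integral_kendall_kernel[of "\<lambda>z. ennreal (williamson \<alpha> t z)" x y \<alpha>, folded \<rho>_def]
    show ?thesis
    proof (cases "y \<le> t")
      case True
      have w: "0 \<le> w" "w \<le> 1" using powr_divide_le_1[of \<alpha> y t] y True assms by (auto simp: w_def)
      then have "\<rho> * w \<le> 1" using \<rho> by (simp add: mult_le_one)
      have "(\<integral>\<^sup>+z. ennreal (williamson \<alpha> t z) \<partial>kendall_kernel \<alpha> x y)
          = ennreal (1 - \<rho>) * ennreal (1 - w) + ennreal \<rho> * ennreal ((1 - w)\<^sup>2)"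
        using 1 y le True assms w
        by (simp add: nn_integral_williamson_kendall_pareto williamson_def[of _ _ y] w_def)
      also have "\<dots> = ennreal ((1 - \<rho>) * (1 - w) + \<rho> * (1 - w)\<^sup>2)"
        using \<rho> w by (simp add: ennreal_mult)
      also have "(1 - \<rho>) * (1 - w) + \<rho> * (1 - w)\<^sup>2 = (1 - \<rho> * w) * (1 - w)"
        by (simp add: power2_eq_square algebra_simps)
      finally show ?thesis
        using \<open>\<rho> * w \<le> 1\<close> w
        by (simp add: williamson_def u w_def[symmetric] ennreal_mult)
    next
      case False
      \<comment> \<open>The kernel is carried by points at or above \<open>y\<close>, hence above
        \<open>t\<close>, where the transform function vanishes; so both sides are 0.\<close>
      have zero: "williamson \<alpha> t (y * z) = 0" if "1 \<le> z" for z
      proof -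
        have "y * 1 \<le> y * z" using y that by (intro mult_left_mono) auto
        then have "t < y * z" using False by simp
        from less_powr_divide[OF assms(1,2) this] show ?thesis by (simp add: williamson_def max_def)
      qed
      have "(\<integral>\<^sup>+z. ennreal (williamson \<alpha> t (y * z)) \<partial>kendall_pareto \<alpha>) = (\<integral>\<^sup>+z. 0 \<partial>kendall_pareto \<alpha>)"
        by (intro nn_integral_cong_AE eventually_mono[OF AE_kendall_pareto]) (simp add: zero)
      then show ?thesis
        using 1 y le zero[of 1] by simp
    qed
  qed
qed

text \<open>For x \<le> y \<le> t and y > 0, the atom at \<open>y\<close> contributes
  \<open>1 - \<rho>\<close> and the Pareto part \<open>\<rho> * (1 - w^2)\<close>; the total is
  \<open>1 - (\<rho> * w) * w\<close>, where \<open>\<rho> * w\<close> is the scaled power of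
  \<open>x\<close>. If the larger argument exceeds \<open>t\<close>, all mass lies above
  \<open>t\<close>.\<close>

lemma emeasure_kendall_kernel_atMost:
  assumes "\<alpha> > 0" "t > 0" "0 \<le> x" "0 \<le> y"
  shows "emeasure (kendall_kernel \<alpha> x y) {..t}
    = (if x \<le> t \<and> y \<le> t then ennreal (1 - (x powr \<alpha> / t powr \<alpha>) * (y powr \<alpha> / t powr \<alpha>)) else 0)"
  using assms(3,4)
proof (induction x y rule: linorder_wlog)
  case (sym x y)
  then show ?case by (simp add: kendall_kernel_commute mult.commute conj_commute)
next
  case (le x y)
  show ?case
  proof (cases "y = 0")
    case True
    with le assms show ?thesis by (simp add: kendall_kernel_def)
  next
    case False
    with le have y: "y > 0" by simp
    define \<rho> where "\<rho> = (x / y) powr \<alpha>"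
    define w where "w = y powr \<alpha> / t powr \<alpha>"
    have \<rho>: "0 \<le> \<rho>" "\<rho> \<le> 1"
      using powr_divide_le_1[of \<alpha> x y] le assms by (auto simp: \<rho>_def powr_divide)
    have u: "x powr \<alpha> / t powr \<alpha> = \<rho> * w"
      using y le by (simp add: \<rho>_def w_def powr_divide)
    have sets: "sets (kendall_kernel \<alpha> x y) = sets borel"
      using y le by (simp add: kendall_kernel_def)
    have "emeasure (kendall_kernel \<alpha> x y) {..t} = (\<integral>\<^sup>+z. indicator {..t} z \<partial>kendall_kernel \<alpha> x y)"
      using sets by simp
    also have "\<dots> = ennreal (1 - \<rho>) * indicator {..t} y
        + ennreal \<rho> * (\<integral>\<^sup>+z. indicator {..t} (y * z) \<partial>kendall_pareto \<alpha>)"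
      unfolding \<rho>_def using y le by (intro nn_integral_kendall_kernel) auto
    also have "(\<integral>\<^sup>+z. indicator {..t} (y * z) \<partial>kendall_pareto \<alpha>)
        = (\<integral>\<^sup>+z. indicator {..t / y} z \<partial>kendall_pareto \<alpha>)"
      using y by (intro nn_integral_cong) (auto simp: indicator_def field_simps)
    also have "\<dots> = emeasure (kendall_pareto \<alpha>) {..t / y}" by simp
    finally have 1: "emeasure (kendall_kernel \<alpha> x y) {..t}
      = ennreal (1 - \<rho>) * indicator {..t} y + ennreal \<rho> * emeasure (kendall_pareto \<alpha>) {..t / y}" .
    show ?thesis
    proof (cases "y \<le> t")
      case True
      have w: "0 \<le> w" "w \<le> 1" using powr_divide_le_1[of \<alpha> y t] y True assms by (auto simp: w_def)
      have "(t / y) powr (- 2 * \<alpha>) = w\<^sup>2"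
      proof -
        have "(t / y) powr (- 2 * \<alpha>) = (t / y) powr (- \<alpha>) * (t / y) powr (- \<alpha>)"
          by (simp flip: powr_add)
        also have "(t / y) powr (- \<alpha>) = w"
          using y assms by (simp add: w_def powr_minus powr_divide)
        finally show ?thesis by (simp add: power2_eq_square)
      qed
      then have "emeasure (kendall_kernel \<alpha> x y) {..t} = ennreal (1 - \<rho>) + ennreal \<rho> * ennreal (1 - w\<^sup>2)"
        using 1 True y assms by (simp add: emeasure_kendall_pareto_atMost)
      also have "\<dots> = ennreal ((1 - \<rho>) + \<rho> * (1 - w\<^sup>2))"
        using \<rho> w by (simp add: ennreal_mult power_le_one)
      also have "(1 - \<rho>) + \<rho> * (1 - w\<^sup>2) = 1 - (\<rho> * w) * w"
        by (simp add: power2_eq_square algebra_simps)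
      finally show ?thesis
        using True le by (simp add: u w_def[symmetric])
    next
      case False
      with y have "t / y < 1" by (simp add: divide_less_eq)
      then have "AE z in kendall_pareto \<alpha>. \<not> z \<le> t / y"
        by (intro eventually_mono[OF AE_kendall_pareto]) simp
      from emeasure_eq_0_AE[OF this] have "emeasure (kendall_pareto \<alpha>) {..t / y} = 0"
        by (simp add: kendall_pareto_def atMost_def)
      then show ?thesis using 1 False by simp
    qed
  qed
qed

section \<open>From the kernel to convolutions of arbitrary laws\<close>

lemma nn_integral_kendall_conv:
  assumes "\<alpha> > 0" "real_distribution \<mu>" "real_distribution \<nu>" "f \<in> borel_measurable borel"
  shows "(\<integral>\<^sup>+z. f z \<partial>kendall_conv \<alpha> \<mu> \<nu>)
    = (\<integral>\<^sup>+x. \<integral>\<^sup>+y. \<integral>\<^sup>+z. f z \<partial>kendall_kernel \<alpha> x y \<partial>\<nu> \<partial>\<mu>)"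
proof -
  have sets: "sets \<mu> = sets borel" "sets \<nu> = sets borel"
    using assms(2,3) by (auto simp: real_distribution_def real_distribution_axioms_def)
  have outer: "(\<lambda>x. \<nu> \<bind> (\<lambda>y. kendall_kernel \<alpha> x y)) \<in> \<mu> \<rightarrow>\<^sub>M subprob_algebra borel"
    using measurable_prob_algebraD[OF measurable_kendall_conv_kernel[OF assms(1,3)]]
    by (simp cong: measurable_cong_sets add: sets)
  have inner: "(\<lambda>y. kendall_kernel \<alpha> x y) \<in> \<nu> \<rightarrow>\<^sub>M subprob_algebra borel" for x
    using assms(1) sets by (intro measurable_prob_algebraD) simp
  show ?thesis
    unfolding kendall_conv_def nn_integral_bind[OF assms(4) outer]
    by (rule nn_integral_cong) (rule nn_integral_bind[OF assms(4) inner])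
qed

lemma
  assumes "\<alpha> > 0" "real_distribution \<nu>" "A \<in> sets borel"
  shows emeasure_bind_kendall_kernel:
      "emeasure (\<nu> \<bind> (\<lambda>y. kendall_kernel \<alpha> x y)) A = (\<integral>\<^sup>+y. emeasure (kendall_kernel \<alpha> x y) A \<partial>\<nu>)"
    and borel_measurable_nn_integral_kendall_kernel:
      "(\<lambda>x. \<integral>\<^sup>+y. emeasure (kendall_kernel \<alpha> x y) A \<partial>\<nu>) \<in> borel_measurable borel"
proof -
  have \<nu>: "\<nu> \<in> space (prob_algebra borel)"
    using assms(2) by (auto simp: space_prob_algebra real_distribution_def real_distribution_axioms_def)
  show *: "emeasure (\<nu> \<bind> (\<lambda>y. kendall_kernel \<alpha> x y)) A
      = (\<integral>\<^sup>+y. emeasure (kendall_kernel \<alpha> x y) A \<partial>\<nu>)" for x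
    using assms(1) by (intro emeasure_bind_prob_algebra[OF \<nu> _ assms(3)]) simp
  have "(\<lambda>x. emeasure (\<nu> \<bind> (\<lambda>y. kendall_kernel \<alpha> x y)) A) \<in> borel_measurable borel"
    by (rule measurable_compose[OF measurable_prob_algebraD[OF measurable_kendall_conv_kernel[OF assms(1,2)]]
          measurable_emeasure_subprob_algebra[OF assms(3)]])
  then show "(\<lambda>x. \<integral>\<^sup>+y. emeasure (kendall_kernel \<alpha> x y) A \<partial>\<nu>) \<in> borel_measurable borel"
    by (simp only: *)
qed

text \<open>The kernel identity separates the variables, so the double integral factors. It speaks
  of nonnegative arguments, hence the almost sure signs.\<close>

lemma nn_integral_williamson_kendall_conv:
  assumes "\<alpha> > 0" "t > 0" "real_distribution \<mu>" "real_distribution \<nu>"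
    "AE x in \<mu>. 0 \<le> x" "AE y in \<nu>. 0 \<le> y"
  shows "(\<integral>\<^sup>+z. ennreal (williamson \<alpha> t z) \<partial>kendall_conv \<alpha> \<mu> \<nu>)
    = (\<integral>\<^sup>+x. ennreal (williamson \<alpha> t x) \<partial>\<mu>) * (\<integral>\<^sup>+y. ennreal (williamson \<alpha> t y) \<partial>\<nu>)"
proof -
  interpret \<mu>: real_distribution \<mu> by fact
  interpret \<nu>: real_distribution \<nu> by fact
  have "(\<integral>\<^sup>+z. ennreal (williamson \<alpha> t z) \<partial>kendall_conv \<alpha> \<mu> \<nu>)
      = (\<integral>\<^sup>+x. \<integral>\<^sup>+y. \<integral>\<^sup>+z. ennreal (williamson \<alpha> t z) \<partial>kendall_kernel \<alpha> x y \<partial>\<nu> \<partial>\<mu>)"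
    using assms by (intro nn_integral_kendall_conv) auto
  also have "\<dots> = (\<integral>\<^sup>+x. \<integral>\<^sup>+y. ennreal (williamson \<alpha> t x) * ennreal (williamson \<alpha> t y) \<partial>\<nu> \<partial>\<mu>)"
    using assms(5)
  proof (intro nn_integral_cong_AE, eventually_elim)
    fix x :: real assume "0 \<le> x"
    then show "(\<integral>\<^sup>+y. \<integral>\<^sup>+z. ennreal (williamson \<alpha> t z) \<partial>kendall_kernel \<alpha> x y \<partial>\<nu>)
        = (\<integral>\<^sup>+y. ennreal (williamson \<alpha> t x) * ennreal (williamson \<alpha> t y) \<partial>\<nu>)"
      using assms
      by (intro nn_integral_cong_AE eventually_mono[OF assms(6)])
         (simp add: nn_integral_williamson_kendall_kernel)
  qed
  also have "\<dots> = (\<integral>\<^sup>+x. ennreal (williamson \<alpha> t x) \<partial>\<mu>) * (\<integral>\<^sup>+y. ennreal (williamson \<alpha> t y) \<partial>\<nu>)"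
    by (simp add: nn_integral_cmult nn_integral_multc)
  finally show ?thesis .
qed

text \<open>The integral separates because \<open>1 - u * v = (1 - v) + (1 - u) * v\<close>: the
  first term is the transform in \<open>y\<close>, cut off at x \<le> t, and the second is the
  transform in \<open>x\<close> times the integrand of H(t) / t^\<alpha>. When \<open>x\<close> or
  \<open>y\<close> exceeds \<open>t\<close>, both products vanish, in agreement with the
  kernel.\<close>

lemma emeasure_kendall_conv_atMost:
  assumes "\<alpha> > 0" "t > 0" "real_distribution \<mu>" "real_distribution \<nu>"
    "AE x in \<mu>. 0 \<le> x" "AE y in \<nu>. 0 \<le> y"
  shows "emeasure (kendall_conv \<alpha> \<mu> \<nu>) {..t}
    = emeasure \<mu> {..t} * (\<integral>\<^sup>+y. ennreal (williamson \<alpha> t y) \<partial>\<nu>)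
      + (\<integral>\<^sup>+x. ennreal (williamson \<alpha> t x) \<partial>\<mu>)
        * (\<integral>\<^sup>+y. ennreal (y powr \<alpha> / t powr \<alpha>) * indicator {..t} y \<partial>\<nu>)"
proof -
  interpret \<mu>: real_distribution \<mu> by fact
  interpret \<nu>: real_distribution \<nu> by fact
  let ?w = "\<lambda>x. ennreal (williamson \<alpha> t x)"
  let ?h = "\<lambda>y. ennreal (y powr \<alpha> / t powr \<alpha>) * indicator {..t} y"
  have kernel: "emeasure (kendall_kernel \<alpha> x y) {..t} = indicator {..t} x * ?w y + ?w x * ?h y"
    if "0 \<le> x" "0 \<le> y" for x y
  proof -
    define u v where "u = x powr \<alpha> / t powr \<alpha>" and "v = y powr \<alpha> / t powr \<alpha>"
    have uv: "0 \<le> u" "0 \<le> v" "x \<le> t \<Longrightarrow> u \<le> 1" "y \<le> t \<Longrightarrow> v \<le> 1"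
      "\<not> x \<le> t \<Longrightarrow> 1 < u" "\<not> y \<le> t \<Longrightarrow> 1 < v"
      using that assms powr_divide_le_1[of \<alpha> _ t] less_powr_divide[of \<alpha> t] by (auto simp: u_def v_def)
    have "ennreal (1 - u * v) = ennreal (1 - v) + ennreal (1 - u) * ennreal v" if "x \<le> t" "y \<le> t"
    proof -
      have "ennreal (1 - u * v) = ennreal ((1 - v) + (1 - u) * v)" by (simp add: algebra_simps)
      also have "\<dots> = ennreal (1 - v) + ennreal (1 - u) * ennreal v"
        using uv that by (simp add: ennreal_mult)
      finally show ?thesis .
    qed
    then show ?thesis
      using that assms uv
      by (auto simp: emeasure_kendall_kernel_atMost williamson_def max_def u_def[symmetric] v_def[symmetric])
  qed
  have "emeasure (kendall_conv \<alpha> \<mu> \<nu>) {..t}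
      = (\<integral>\<^sup>+x. \<integral>\<^sup>+y. emeasure (kendall_kernel \<alpha> x y) {..t} \<partial>\<nu> \<partial>\<mu>)"
    using assms by (intro emeasure_kendall_conv) auto
  also have "\<dots> = (\<integral>\<^sup>+x. \<integral>\<^sup>+y. indicator {..t} x * ?w y + ?w x * ?h y \<partial>\<nu> \<partial>\<mu>)"
    using assms(5)
  proof (intro nn_integral_cong_AE, eventually_elim)
    fix x :: real assume "0 \<le> x"
    then show "(\<integral>\<^sup>+y. emeasure (kendall_kernel \<alpha> x y) {..t} \<partial>\<nu>)
        = (\<integral>\<^sup>+y. indicator {..t} x * ?w y + ?w x * ?h y \<partial>\<nu>)"
      by (intro nn_integral_cong_AE eventually_mono[OF assms(6)] kernel)
  qed
  also have "\<dots> = emeasure \<mu> {..t} * (\<integral>\<^sup>+y. ?w y \<partial>\<nu>) + (\<integral>\<^sup>+x. ?w x \<partial>\<mu>) * (\<integral>\<^sup>+y. ?h y \<partial>\<nu>)"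
    by (simp add: nn_integral_add nn_integral_cmult nn_integral_multc)
  finally show ?thesis .
qed

section \<open>One step of the random walk\<close>

lemma half_line_distributionsD:
  assumes "\<nu> \<in> half_line_distributions"
  shows "real_distribution \<nu>" "AE x in \<nu>. 0 \<le> x"
proof -
  show *: "real_distribution \<nu>" using assms by (simp add: half_line_distributions_def)
  interpret real_distribution \<nu> by fact
  show "AE x in \<nu>. 0 \<le> x"
    using assms by (intro AE_I[of _ _ "{..<0}"]) (auto simp: half_line_distributions_def)
qed

text \<open>The one-step transition in \<open>kendall_random_walk\<close> is phrased with this
  power, which unfolds to a convolution with the unit mass at 0. That mass is neutral on the
  half-line, which carries \<open>\<nu>\<close>.\<close>

lemma kendall_power_1:
  assumes "\<alpha> > 0" "\<nu> \<in> half_line_distributions"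
  shows "kendall_power \<alpha> \<nu> (Suc 0) = \<nu>"
proof (rule measure_eqI)
  note \<nu> = half_line_distributionsD[OF assms(2)]
  interpret \<nu>: real_distribution \<nu> by fact
  have "real_distribution (return borel (0::real))"
    by (simp add: real_distribution_def real_distribution_axioms_def prob_space_return)
  note conv = emeasure_kendall_conv[OF assms(1) this \<nu>(1)]
    real_distribution_kendall_conv[OF assms(1) this \<nu>(1)]
  show sets: "sets (kendall_power \<alpha> \<nu> (Suc 0)) = sets \<nu>"
    using real_distribution.events_eq_borel[OF conv(2)] by simp
  fix A assume "A \<in> sets (kendall_power \<alpha> \<nu> (Suc 0))"
  then have [measurable]: "A \<in> sets borel" using sets by simp
  have [measurable]: "(\<lambda>x. \<integral>\<^sup>+y. emeasure (kendall_kernel \<alpha> x y) A \<partial>\<nu>) \<in> borel_measurable borel"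
    by (rule borel_measurable_nn_integral_kendall_kernel[OF assms(1) \<nu>(1)]) simp
  have "emeasure (kendall_power \<alpha> \<nu> (Suc 0)) A = (\<integral>\<^sup>+y. emeasure (kendall_kernel \<alpha> 0 y) A \<partial>\<nu>)"
    by (simp add: conv(1) nn_integral_return)
  also have "\<dots> = (\<integral>\<^sup>+y. indicator A y \<partial>\<nu>)"
    using \<nu>(2) assms(1)
    by (intro nn_integral_cong_AE) (auto simp: kendall_kernel_0_left)
  finally show "emeasure (kendall_power \<alpha> \<nu> (Suc 0)) A = emeasure \<nu> A" by simp
qed

text \<open>Turns the conditional-expectation form of the Markov property into an ordinary integral.
  The event \<open>B\<close> serves two ends: \<open>UNIV\<close> gives the law of the next
  position, and \<open>{t<..}\<close> rules out returns below \<open>t\<close>.\<close>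

lemma kendall_random_walk_step:
  assumes "\<alpha> > 0" "\<nu> \<in> half_line_distributions" "kendall_random_walk \<alpha> \<nu> M S" "1 \<le> k"
    and [measurable]: "A \<in> sets borel" "B \<in> sets borel"
  shows "emeasure M {\<omega>\<in>space M. S k \<omega> \<in> B \<and> S (Suc k) \<omega> \<in> A}
    = (\<integral>\<^sup>+\<omega>. indicator B (S k \<omega>) * (\<integral>\<^sup>+y. emeasure (kendall_kernel \<alpha> (S k \<omega>) y) A \<partial>\<nu>) \<partial>M)"
proof -
  note \<nu> = half_line_distributionsD[OF assms(2)]
  interpret \<nu>: real_distribution \<nu> by fact
  interpret M: prob_space M using assms(3) by (simp add: kendall_random_walk_def)
  have [measurable]: "S n \<in> borel_measurable M" if "1 \<le> n" for n
    using assms(3) that by (simp add: kendall_random_walk_def)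
  have [measurable]: "S k \<in> borel_measurable M" "S (Suc k) \<in> borel_measurable M"
    using assms(4) by simp_all
  define \<kappa> where "\<kappa> x = \<nu> \<bind> (\<lambda>y. kendall_kernel \<alpha> x y)" for x
  have \<kappa> [measurable]: "\<kappa> \<in> borel \<rightarrow>\<^sub>M prob_algebra borel"
    unfolding \<kappa>_def by (rule measurable_kendall_conv_kernel[OF assms(1) \<nu>(1)])
  have \<kappa>_prob: "prob_space (\<kappa> x)" and \<kappa>_sets: "sets (\<kappa> x) = sets borel" for x
    using measurable_space[OF \<kappa>, of x] by (auto simp: space_prob_algebra)
  have \<kappa>_emeasure: "emeasure (\<kappa> x) A = (\<integral>\<^sup>+y. emeasure (kendall_kernel \<alpha> x y) A \<partial>\<nu>)" for x
    unfolding \<kappa>_def by (rule emeasure_bind_kendall_kernel[OF assms(1) \<nu>(1)]) simp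
  \<comment> \<open>Binding a point mass to \<open>\<kappa>\<close> evaluates
    \<open>\<kappa>\<close> at that point.\<close>
  have conv: "kendall_conv \<alpha> (return borel x) (kendall_power \<alpha> \<nu> (Suc 0)) = \<kappa> x" for x
    unfolding kendall_power_1[OF assms(1,2)] kendall_conv_def \<kappa>_def[symmetric]
    by (intro bind_return[OF measurable_prob_algebraD[OF \<kappa>]]) simp
  define F where "F = natural_history M S k"
  let ?g = "indicator (S (Suc k) -` A \<inter> space M) :: _ \<Rightarrow> real"
  define gen where "gen = (\<Union>i\<in>{1..k}. {S i -` A \<inter> space M | A. A \<in> sets borel})"
  have gen_Pow: "gen \<subseteq> Pow (space M)" by (auto simp: gen_def)
  have gen_sets: "gen \<subseteq> sets M" by (auto simp: gen_def)
  have F: "space F = space M" "sets F = sigma_sets (space M) gen"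
    unfolding F_def natural_history_def gen_def[symmetric]
    by (simp_all add: gen_Pow)
  have sub: "subalgebra M F"
    using sets.sigma_sets_subset[OF gen_sets] by (simp add: subalgebra_def F)
  interpret F: finite_measure_subalgebra M F
    by standard (rule sub)
  \<comment> \<open>The defining property of the conditional expectation holds on events of the
    history. \<open>C\<close> is such an event because \<open>1 \<le> k\<close> puts
    \<open>S k\<close> among the generators.\<close>
  define C where "C = S k -` B \<inter> space M"
  have "C \<in> sets F"
    unfolding F C_def gen_def using assms(4,6) by (intro sigma_sets.Basic UN_I[of k]) auto
  have [measurable]: "C \<in> sets M" unfolding C_def by measurable
  have AE: "AE \<omega> in M. real_cond_exp M F ?g \<omega> = measure (\<kappa> (S k \<omega>)) A"
  proof -
    have "AE \<omega> in M. real_cond_exp M (natural_history M S k) (indicator (S (Suc k) -` A \<inter> space M)) \<omega>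
       = measure (kendall_conv \<alpha> (return borel (S k \<omega>)) (kendall_power \<alpha> \<nu> (Suc k - k))) A"
      using assms(3-5) unfolding kendall_random_walk_def by blast
    then show ?thesis
      unfolding F_def Suc_diff_le[OF order_refl] diff_self_eq_0 conv .
  qed
  have [measurable]: "(\<lambda>\<omega>. measure (\<kappa> (S k \<omega>)) A) \<in> borel_measurable M"
    using measurable_compose[OF \<open>S k \<in> borel_measurable M\<close>
        borel_measurable_nn_integral_kendall_kernel[OF assms(1) \<nu>(1) assms(5)]]
    unfolding measure_def \<kappa>_emeasure by measurable
  have int: "integrable M (\<lambda>\<omega>. indicator C \<omega> * measure (\<kappa> (S k \<omega>)) A)"
    by (intro M.integrable_const_bound[where B = 1])
       (auto simp: indicator_def prob_space.prob_le_1[OF \<kappa>_prob])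
  have "{\<omega>\<in>space M. S k \<omega> \<in> B \<and> S (Suc k) \<omega> \<in> A} = C \<inter> (S (Suc k) -` A \<inter> space M)"
    by (auto simp: C_def)
  then have "measure M {\<omega>\<in>space M. S k \<omega> \<in> B \<and> S (Suc k) \<omega> \<in> A} = (LINT \<omega>:C|M. ?g \<omega>)"
    by (simp add: set_lebesgue_integral_def flip: indicator_inter_arith)
  also have "\<dots> = (LINT \<omega>:C|M. real_cond_exp M F ?g \<omega>)"
    by (intro F.real_cond_exp_intA \<open>C \<in> sets F\<close> integrable_real_indicator)
       (auto simp: M.emeasure_eq_measure intro!: measurable_sets)
  also have "\<dots> = (LINT \<omega>|M. indicator C \<omega> * measure (\<kappa> (S k \<omega>)) A)"
    unfolding set_lebesgue_integral_def using AE by (intro integral_cong_AE) auto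
  finally have "emeasure M {\<omega>\<in>space M. S k \<omega> \<in> B \<and> S (Suc k) \<omega> \<in> A}
      = ennreal (LINT \<omega>|M. indicator C \<omega> * measure (\<kappa> (S k \<omega>)) A)"
    by (simp add: M.emeasure_eq_measure)
  also have "\<dots> = (\<integral>\<^sup>+\<omega>. ennreal (indicator C \<omega> * measure (\<kappa> (S k \<omega>)) A) \<partial>M)"
    by (intro nn_integral_eq_integral[symmetric] int) simp
  also have "\<dots> = (\<integral>\<^sup>+\<omega>. indicator B (S k \<omega>) * emeasure (\<kappa> (S k \<omega>)) A \<partial>M)"
    by (intro nn_integral_cong)
       (auto simp: C_def indicator_def finite_measure.emeasure_eq_measure prob_space.finite_measure \<kappa>_prob)
  finally show ?thesis by (simp only: \<kappa>_emeasure)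
qed

text \<open>A kernel with an argument above \<open>t\<close> gives no mass to \<open>{..t}\<close>,
  so stepping from above \<open>t\<close> to at most \<open>t\<close> is a null event.\<close>

lemma kendall_random_walk_AE_mono:
  assumes "\<alpha> > 0" "t > 0" "\<nu> \<in> half_line_distributions" "kendall_random_walk \<alpha> \<nu> M S" "1 \<le> k"
  shows "AE \<omega> in M. S (Suc k) \<omega> \<le> t \<longrightarrow> S k \<omega> \<le> t"
proof -
  have M: "S n \<in> borel_measurable M" "\<And>\<omega>. \<omega> \<in> space M \<Longrightarrow> 0 \<le> S n \<omega>" if "1 \<le> n" for n
    using assms(4) that by (auto simp: kendall_random_walk_def)
  have [measurable]: "S k \<in> borel_measurable M" "S (Suc k) \<in> borel_measurable M"
    using assms(5) M by simp_all
  have "emeasure M {\<omega>\<in>space M. S k \<omega> \<in> {t<..} \<and> S (Suc k) \<omega> \<in> {..t}}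
      = (\<integral>\<^sup>+\<omega>. indicator {t<..} (S k \<omega>) * (\<integral>\<^sup>+y. emeasure (kendall_kernel \<alpha> (S k \<omega>) y) {..t} \<partial>\<nu>) \<partial>M)"
    using assms by (intro kendall_random_walk_step) auto
  also have "\<dots> = (\<integral>\<^sup>+\<omega>. 0 \<partial>M)"
  proof (rule nn_integral_cong)
    fix \<omega> assume \<omega>: "\<omega> \<in> space M"
    have "(\<integral>\<^sup>+y. emeasure (kendall_kernel \<alpha> (S k \<omega>) y) {..t} \<partial>\<nu>) = (\<integral>\<^sup>+y. 0 \<partial>\<nu>)" if "t < S k \<omega>"
      using that assms M(2)[OF assms(5) \<omega>]
      by (intro nn_integral_cong_AE eventually_mono[OF half_line_distributionsD(2)[OF assms(3)]])
         (simp add: emeasure_kendall_kernel_atMost)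
    then show "indicator {t<..} (S k \<omega>) * (\<integral>\<^sup>+y. emeasure (kendall_kernel \<alpha> (S k \<omega>) y) {..t} \<partial>\<nu>) = 0"
      by (auto simp: indicator_def)
  qed
  finally have "emeasure M {\<omega>\<in>space M. \<not> (S (Suc k) \<omega> \<le> t \<longrightarrow> S k \<omega> \<le> t)} = 0"
    by (simp add: not_le conj_commute)
  then show ?thesis
    by (intro AE_I[OF order_refl]) auto
qed

lemma distr_kendall_random_walk_Suc:
  assumes "\<alpha> > 0" "\<nu> \<in> half_line_distributions" "kendall_random_walk \<alpha> \<nu> M S" "1 \<le> k"
  shows "distr M borel (S (Suc k)) = kendall_conv \<alpha> (distr M borel (S k)) \<nu>"
proof (rule measure_eqI)
  note \<nu> = half_line_distributionsD[OF assms(2)]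
  interpret \<nu>: real_distribution \<nu> by fact
  interpret M: prob_space M using assms(3) by (simp add: kendall_random_walk_def)
  have [measurable]: "S k \<in> borel_measurable M" "S (Suc k) \<in> borel_measurable M"
    using assms(3,4) by (auto simp: kendall_random_walk_def)
  have dist: "real_distribution (distr M borel (S k))" by (rule M.real_distribution_distr) simp
  show sets: "sets (distr M borel (S (Suc k))) = sets (kendall_conv \<alpha> (distr M borel (S k)) \<nu>)"
    using real_distribution.events_eq_borel[OF real_distribution_kendall_conv[OF assms(1) dist \<nu>(1)]] by simp
  fix A assume "A \<in> sets (distr M borel (S (Suc k)))"
  then have [measurable]: "A \<in> sets borel" by simp
  have [measurable]: "(\<lambda>x. \<integral>\<^sup>+y. emeasure (kendall_kernel \<alpha> x y) A \<partial>\<nu>) \<in> borel_measurable borel"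
    by (rule borel_measurable_nn_integral_kendall_kernel[OF assms(1) \<nu>(1)]) simp
  have "emeasure (distr M borel (S (Suc k))) A = emeasure M {\<omega>\<in>space M. S k \<omega> \<in> UNIV \<and> S (Suc k) \<omega> \<in> A}"
    by (subst emeasure_distr) (auto intro!: arg_cong[where f = "emeasure M"])
  also have "\<dots> = (\<integral>\<^sup>+\<omega>. indicator UNIV (S k \<omega>) * (\<integral>\<^sup>+y. emeasure (kendall_kernel \<alpha> (S k \<omega>) y) A \<partial>\<nu>) \<partial>M)"
    using assms by (intro kendall_random_walk_step) auto
  also have "\<dots> = (\<integral>\<^sup>+x. \<integral>\<^sup>+y. emeasure (kendall_kernel \<alpha> x y) A \<partial>\<nu> \<partial>distr M borel (S k))"
    by (simp add: nn_integral_distr)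
  also have "\<dots> = emeasure (kendall_conv \<alpha> (distr M borel (S k)) \<nu>) A"
    using assms(1) dist \<nu>(1) by (intro emeasure_kendall_conv[symmetric]) auto
  finally show "emeasure (distr M borel (S (Suc k))) A
    = emeasure (kendall_conv \<alpha> (distr M borel (S k)) \<nu>) A" .
qed

section \<open>Power series for the two moments\<close>

lemma Suc_mult_Suc_Suc_geometric_sums:
  fixes z :: real
  assumes "\<bar>z\<bar> < 1"
  shows "(\<lambda>n. real (Suc n) * real (Suc (Suc n)) * z ^ n) sums (2 / (1 - z) ^ 3)"
proof -
  \<comment> \<open>One more termwise differentiation, applied to the series of
    \<open>1 / (1 - x)^2\<close>.\<close>
  have "(\<lambda>n. diffs (\<lambda>n. real (Suc n)) n * z ^ n) sums (2 / (1 - z) ^ 3)"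
  proof (rule termdiffs_sums_strong)
    fix x :: real assume "norm x < 1"
    then show "(\<lambda>n. real (Suc n) * x ^ n) sums (1 / (1 - x)\<^sup>2)"
      by (rule geometric_deriv_sums)
  next
    show "((\<lambda>x. 1 / (1 - x)\<^sup>2) has_field_derivative 2 / (1 - z) ^ 3) (at z)"
      using assms
      by (auto intro!: derivative_eq_intros simp: divide_simps power2_eq_square power3_eq_cube)
  qed (use assms in auto)
  then show ?thesis by (simp add: diffs_def)
qed

lemma tail_sums:
  fixes G h :: real
  assumes "0 \<le> G" "G < 1"
  shows "(\<lambda>n. G ^ Suc n + real (Suc n) * G ^ n * h) sums (G / (1 - G) + h / (1 - G)\<^sup>2)"
    and "(\<lambda>n. real (2 * n + 1) * (G ^ Suc n + real (Suc n) * G ^ n * h))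
      sums ((h * (1 + 3 * G) + G * (1 - G\<^sup>2)) / (1 - G) ^ 3)"
proof -
  have s0: "(\<lambda>n. G ^ n) sums (1 / (1 - G))"
    using assms by (intro geometric_sums) auto
  have s1: "(\<lambda>n. real (Suc n) * G ^ n) sums (1 / (1 - G)\<^sup>2)"
    using assms by (intro geometric_deriv_sums) auto
  have s2: "(\<lambda>n. real (Suc n) * real (Suc (Suc n)) * G ^ n) sums (2 / (1 - G) ^ 3)"
    using assms by (intro Suc_mult_Suc_Suc_geometric_sums) auto
  show "(\<lambda>n. G ^ Suc n + real (Suc n) * G ^ n * h) sums (G / (1 - G) + h / (1 - G)\<^sup>2)"
    using sums_add[OF sums_mult[OF s0, of G] sums_mult2[OF s1, of h]] by simp
  \<comment> \<open>The weights are rewritten in the basis of the three known series: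
    \<open>2n + 1 = 2(n+1) - 1\<close> and
    \<open>(2n+1)(n+1) = 2(n+1)(n+2) - 3(n+1)\<close>.\<close>
  have "(\<lambda>n. G * (2 * (real (Suc n) * G ^ n) - G ^ n)
        + h * (2 * (real (Suc n) * real (Suc (Suc n)) * G ^ n) - 3 * (real (Suc n) * G ^ n)))
      sums (G * (2 * (1 / (1 - G)\<^sup>2) - 1 / (1 - G)) + h * (2 * (2 / (1 - G) ^ 3) - 3 * (1 / (1 - G)\<^sup>2)))"
    by (intro sums_add sums_diff sums_mult s0 s1 s2)
  also have "(\<lambda>n. G * (2 * (real (Suc n) * G ^ n) - G ^ n)
        + h * (2 * (real (Suc n) * real (Suc (Suc n)) * G ^ n) - 3 * (real (Suc n) * G ^ n)))
      = (\<lambda>n. real (2 * n + 1) * (G ^ Suc n + real (Suc n) * G ^ n * h))"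
    by (simp add: fun_eq_iff algebra_simps)
  also have "G * (2 * (1 / (1 - G)\<^sup>2) - 1 / (1 - G)) + h * (2 * (2 / (1 - G) ^ 3) - 3 * (1 / (1 - G)\<^sup>2))
      = (h * (1 + 3 * G) + G * (1 - G\<^sup>2)) / (1 - G) ^ 3"
  proof -
    have "1 - G \<noteq> 0" using assms by simp
    then have "1 / (1 - G)\<^sup>2 = (1 - G) / (1 - G) ^ 3" "1 / (1 - G) = (1 - G)\<^sup>2 / (1 - G) ^ 3"
      by (simp_all add: power2_eq_square power3_eq_cube)
    then show ?thesis
      by (simp add: add_divide_distrib[symmetric] diff_divide_distrib[symmetric]
          power2_eq_square algebra_simps)
  qed
  finally show "(\<lambda>n. real (2 * n + 1) * (G ^ Suc n + real (Suc n) * G ^ n * h))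
      sums ((h * (1 + 3 * G) + G * (1 - G\<^sup>2)) / (1 - G) ^ 3)" .
qed

section \<open>Moments as tail sums, the events N(t) > n, and the variance\<close>

lemma suminf_one_ennreal: "(\<Sum>n. 1 :: ennreal) = \<infinity>"
proof -
  have "(SUP n. of_nat n) \<le> (\<Sum>n. 1 :: ennreal)"
    by (rule SUP_least) (use sum_le_suminf[of "\<lambda>_. 1 :: ennreal" "{..<_}"] in simp)
  then show ?thesis by (simp add: ennreal_SUP_of_nat_eq_top top_unique)
qed

text \<open>The sum counts the numbers below \<open>k\<close>. In \<open>ennreal\<close> it diverges
  to the right value when \<open>k\<close> is infinite, which is how a possibly infinite renewal
  process is covered.\<close>

lemma ennreal_of_enat_eq_suminf: "ennreal_of_enat k = (\<Sum>n. of_bool (enat n < k))"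
proof (cases k)
  case (enat m)
  have "(\<Sum>n. of_bool (enat n < k)) = (\<Sum>n<m. of_bool (enat n < k) :: ennreal)"
    using enat by (intro suminf_finite) auto
  then show ?thesis using enat by simp
qed (simp add: suminf_one_ennreal)

text \<open>The weights are the increments \<open>(n+1)^2 - n^2 = 2n + 1\<close>, which telescope.
  For infinite \<open>k\<close> every term is at least 1, so the sum diverges.\<close>

lemma ennreal_of_enat_power2_eq_suminf:
  "(ennreal_of_enat k)\<^sup>2 = (\<Sum>n. of_nat (2 * n + 1) * of_bool (enat n < k))"
proof (cases k)
  case (enat m)
  have "(\<Sum>n<m. 2 * n + 1) = m\<^sup>2"
    by (induction m) (auto simp: power2_eq_square)
  then have "of_nat (m\<^sup>2) = (\<Sum>n<m. of_nat (2 * n + 1) :: ennreal)"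
    by (metis of_nat_sum)
  also have "\<dots> = (\<Sum>n<m. of_nat (2 * n + 1) * of_bool (enat n < k))"
    using enat by (intro sum.cong) auto
  also have "\<dots> = (\<Sum>n. of_nat (2 * n + 1) * of_bool (enat n < k))"
    using enat by (intro suminf_finite[symmetric]) auto
  finally show ?thesis using enat by simp
next
  case infinity
  have "(\<Sum>n. 1 :: ennreal) \<le> (\<Sum>n. of_nat (2 * n + 1) * of_bool (enat n < k))"
    using infinity by (intro suminf_le) auto
  then show ?thesis
    using infinity by (simp add: suminf_one_ennreal top_unique top_power_ennreal)
qed

lemma less_renewal_process_iff:
  "enat n < renewal_process S t \<omega> \<longleftrightarrow> (\<forall>k\<le>n. S (Suc k) \<omega> \<le> t)"
proof -
  \<comment> \<open>Reading \<open>enat n <\<close> as \<open>enat (Suc n) \<le>\<close> makes the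
    comparison with the infimum a condition on each element, the empty set included.\<close>
  have "enat n < renewal_process S t \<omega> \<longleftrightarrow> (\<forall>m. t < S (Suc m) \<omega> \<longrightarrow> Suc n \<le> m)"
    unfolding renewal_process_def Suc_ile_eq[symmetric] le_Inf_iff by auto
  also have "\<dots> \<longleftrightarrow> (\<forall>k\<le>n. S (Suc k) \<omega> \<le> t)"
    by (meson not_less not_less_eq_eq)
  finally show ?thesis .
qed

text \<open>A finite first moment makes \<open>X\<close> finite almost everywhere, so the default
  value 0 of \<open>enn2real\<close> at infinity is taken on a null set and both moments carry over
  to the real-valued variable.\<close>

lemma (in prob_space) variance_eq_ennreal_moments:
  assumes [measurable]: "X \<in> borel_measurable M"
    and EX: "(\<integral>\<^sup>+\<omega>. X \<omega> \<partial>M) = ennreal a" and EX2: "(\<integral>\<^sup>+\<omega>. (X \<omega>)\<^sup>2 \<partial>M) = ennreal b"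
    and "0 \<le> a" "0 \<le> b"
  shows "variance (\<lambda>\<omega>. enn2real (X \<omega>)) = b - a\<^sup>2"
proof -
  have "AE \<omega> in M. X \<omega> \<noteq> \<infinity>"
    by (rule nn_integral_PInf_AE) (simp_all add: EX)
  then have X: "AE \<omega> in M. ennreal (enn2real (X \<omega>)) = X \<omega>"
    by eventually_elim (simp add: ennreal_enn2real_if)
  then have X2: "AE \<omega> in M. ennreal ((enn2real (X \<omega>))\<^sup>2) = (X \<omega>)\<^sup>2"
    by eventually_elim (simp flip: ennreal_power)
  have 1: "(\<integral>\<^sup>+\<omega>. ennreal (enn2real (X \<omega>)) \<partial>M) = ennreal a"
    "(\<integral>\<^sup>+\<omega>. ennreal ((enn2real (X \<omega>))\<^sup>2) \<partial>M) = ennreal b"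
    using nn_integral_cong_AE[OF X] nn_integral_cong_AE[OF X2] EX EX2 by simp_all
  have "has_bochner_integral M (\<lambda>\<omega>. enn2real (X \<omega>)) a"
    using 1(1) assms(4) by (intro has_bochner_integral_nn_integral) auto
  moreover have "has_bochner_integral M (\<lambda>\<omega>. (enn2real (X \<omega>))\<^sup>2) b"
    using 1(2) assms(5) by (intro has_bochner_integral_nn_integral) auto
  ultimately show ?thesis
    by (subst variance_eq) (auto simp: has_bochner_integral_iff)
qed

section \<open>G(t) and H(t) as integrals over the whole line\<close>

lemma
  assumes "\<nu> \<in> half_line_distributions"
  shows integrable_williamson: "integrable \<nu> (williamson \<alpha> t)"
    and kendall_G_eq_integral_williamson: "kendall_G \<alpha> \<nu> t = (LINT x|\<nu>. williamson \<alpha> t x)"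
proof -
  note \<nu> = half_line_distributionsD[OF assms]
  interpret \<nu>: real_distribution \<nu> by fact
  show "integrable \<nu> (williamson \<alpha> t)"
    by (intro \<nu>.integrable_const_bound[where B = 1]) (auto simp: williamson_nonneg williamson_le_1)
  \<comment> \<open>Negative numbers form a \<open>\<nu>\<close>-null set, so the restriction to
    \<open>{0..}\<close> disappears almost everywhere.\<close>
  show "kendall_G \<alpha> \<nu> t = (LINT x|\<nu>. williamson \<alpha> t x)"
    unfolding kendall_G_def set_lebesgue_integral_def williamson_def
    using \<nu>(2) by (intro integral_cong_AE) (auto simp: indicator_def)
qed

lemma
  assumes "\<alpha> > 0" "t > 0" "\<nu> \<in> half_line_distributions"
  shows nn_integral_williamson_eq_kendall_G:
      "(\<integral>\<^sup>+x. ennreal (williamson \<alpha> t x) \<partial>\<nu>) = ennreal (kendall_G \<alpha> \<nu> t)"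
    and kendall_G_nonneg: "0 \<le> kendall_G \<alpha> \<nu> t"
    and nn_integral_eq_kendall_H:
      "(\<integral>\<^sup>+x. ennreal (x powr \<alpha> / t powr \<alpha>) * indicator {..t} x \<partial>\<nu>)
        = ennreal (kendall_H \<alpha> \<nu> t / t powr \<alpha>)"
    and kendall_H_nonneg: "0 \<le> kendall_H \<alpha> \<nu> t"
proof -
  note \<nu> = half_line_distributionsD[OF assms(3)]
  interpret \<nu>: real_distribution \<nu> by fact
  note G = kendall_G_eq_integral_williamson[OF assms(3), of \<alpha> t]
    and int = integrable_williamson[OF assms(3), of \<alpha> t]
  show "0 \<le> kendall_G \<alpha> \<nu> t"
    unfolding G by (rule Bochner_Integration.integral_nonneg) (rule williamson_nonneg)
  show "(\<integral>\<^sup>+x. ennreal (williamson \<alpha> t x) \<partial>\<nu>) = ennreal (kendall_G \<alpha> \<nu> t)"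
    unfolding G using int by (intro nn_integral_eq_integral) (auto simp: williamson_nonneg)
  have H: "kendall_H \<alpha> \<nu> t / t powr \<alpha> = (LINT x|\<nu>. indicator {..t} x * (x powr \<alpha> / t powr \<alpha>))"
  proof -
    have "kendall_H \<alpha> \<nu> t = (LINT x|\<nu>. indicator {..t} x * x powr \<alpha>)"
      unfolding kendall_H_def set_lebesgue_integral_def
      using \<nu>(2) by (intro integral_cong_AE) (auto simp: indicator_def)
    then show ?thesis by simp
  qed
  show "0 \<le> kendall_H \<alpha> \<nu> t"
    unfolding kendall_H_def set_lebesgue_integral_def by (rule Bochner_Integration.integral_nonneg) simp
  have "integrable \<nu> (\<lambda>x. indicator {..t} x * (x powr \<alpha> / t powr \<alpha>))"
    using \<nu>(2) assms
    by (intro \<nu>.integrable_const_bound[where B = 1])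
       (auto simp: indicator_def intro!: powr_mono2 elim!: eventually_mono)
  then have "(\<integral>\<^sup>+x. ennreal (indicator {..t} x * (x powr \<alpha> / t powr \<alpha>)) \<partial>\<nu>)
      = ennreal (kendall_H \<alpha> \<nu> t / t powr \<alpha>)"
    unfolding H by (intro nn_integral_eq_integral) auto
  also have "(\<integral>\<^sup>+x. ennreal (indicator {..t} x * (x powr \<alpha> / t powr \<alpha>)) \<partial>\<nu>)
      = (\<integral>\<^sup>+x. ennreal (x powr \<alpha> / t powr \<alpha>) * indicator {..t} x \<partial>\<nu>)"
    by (intro nn_integral_cong) (auto simp: indicator_def)
  finally show "(\<integral>\<^sup>+x. ennreal (x powr \<alpha> / t powr \<alpha>) * indicator {..t} x \<partial>\<nu>)
      = ennreal (kendall_H \<alpha> \<nu> t / t powr \<alpha>)" .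
qed

text \<open>The function \<open>1 - W\<close> is nonnegative with integral \<open>1 - G\<close>. If
  G were at least 1, it would vanish almost everywhere; as W equals 1 at 0 alone,
  \<open>\<nu>\<close> would be the unit mass there.\<close>

lemma kendall_G_less_1:
  assumes "\<alpha> > 0" "t > 0" "\<nu> \<in> half_line_distributions" "\<nu> \<noteq> return borel 0"
  shows "kendall_G \<alpha> \<nu> t < 1"
proof (rule ccontr)
  note \<nu> = half_line_distributionsD[OF assms(3)]
  interpret \<nu>: real_distribution \<nu> by fact
  let ?f = "\<lambda>x. 1 - williamson \<alpha> t x"
  note G = kendall_G_eq_integral_williamson[OF assms(3), of \<alpha> t]
    and int = integrable_williamson[OF assms(3), of \<alpha> t]
  assume "\<not> kendall_G \<alpha> \<nu> t < 1"
  moreover have "(LINT x|\<nu>. ?f x) = 1 - kendall_G \<alpha> \<nu> t"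
    using int by (simp add: G \<nu>.prob_space[simplified])
  moreover have "0 \<le> (LINT x|\<nu>. ?f x)"
    by (intro Bochner_Integration.integral_nonneg) (simp add: williamson_le_1)
  ultimately have "(LINT x|\<nu>. ?f x) = 0" by simp
  then have "AE x in \<nu>. ?f x = 0"
    using int by (subst (asm) integral_nonneg_eq_0_iff_AE) (auto simp: williamson_le_1)
  then have AE0: "AE x in \<nu>. x = 0"
    by (rule eventually_mono) (use assms in \<open>auto simp: williamson_def max_def split: if_splits\<close>)
  have "\<nu> = return borel 0"
  proof (rule measure_eqI)
    fix A assume "A \<in> sets \<nu>"
    then have [measurable]: "A \<in> sets borel" by simp
    have "emeasure \<nu> A = (\<integral>\<^sup>+x. indicator A x \<partial>\<nu>)" by simp
    also have "\<dots> = (\<integral>\<^sup>+x. indicator A 0 \<partial>\<nu>)"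
      using AE0 by (intro nn_integral_cong_AE) auto
    finally show "emeasure \<nu> A = emeasure (return borel 0) A"
      using \<nu>.emeasure_space_1 by simp
  qed simp
  with assms(4) show False ..
qed

section \<open>Distribution functions of the walk and moments of the renewal process\<close>

lemma emeasure_kendall_random_walk_le:
  assumes "\<alpha> > 0" "t > 0" "\<nu> \<in> half_line_distributions" "kendall_random_walk \<alpha> \<nu> M S"
  shows "emeasure M {\<omega>\<in>space M. S (Suc n) \<omega> \<le> t}
    = ennreal (kendall_G \<alpha> \<nu> t ^ Suc n
        + real (Suc n) * kendall_G \<alpha> \<nu> t ^ n * (kendall_H \<alpha> \<nu> t / t powr \<alpha>))"
proof -
  note \<nu> = half_line_distributionsD[OF assms(3)]
  interpret \<nu>: real_distribution \<nu> by fact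
  interpret M: prob_space M using assms(4) by (simp add: kendall_random_walk_def)
  define G h where "G = kendall_G \<alpha> \<nu> t" and "h = kendall_H \<alpha> \<nu> t / t powr \<alpha>"
  have nonneg: "0 \<le> G" "0 \<le> h"
    using assms kendall_G_nonneg kendall_H_nonneg by (simp_all add: G_def h_def)
  have G: "(\<integral>\<^sup>+x. ennreal (williamson \<alpha> t x) \<partial>\<nu>) = ennreal G"
    unfolding G_def by (rule nn_integral_williamson_eq_kendall_G[OF assms(1-3)])
  have h: "(\<integral>\<^sup>+x. ennreal (x powr \<alpha> / t powr \<alpha>) * indicator {..t} x \<partial>\<nu>) = ennreal h"
    unfolding h_def by (rule nn_integral_eq_kendall_H[OF assms(1-3)])
  have S [measurable]: "S (Suc n) \<in> borel_measurable M" for n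
    using assms(4) by (simp add: kendall_random_walk_def)
  \<comment> \<open>The index is shifted by one, because the walk begins with \<open>S 1\<close>;
    the induction thus starts from \<open>\<nu>\<close> itself.\<close>
  define \<mu> where "\<mu> n = distr M borel (S (Suc n))" for n
  have S_nonneg: "0 \<le> S (Suc n) \<omega>" if "\<omega> \<in> space M" for n \<omega>
    using assms(4) that by (simp add: kendall_random_walk_def)
  have \<mu>: "real_distribution (\<mu> n)" "AE x in \<mu> n. 0 \<le> x" for n
    unfolding \<mu>_def by (rule M.real_distribution_distr, simp) (simp add: AE_distr_iff S_nonneg)
  have \<mu>_0: "\<mu> 0 = \<nu>"
    using assms(4) by (simp add: \<mu>_def kendall_random_walk_def)
  have \<mu>_Suc: "\<mu> (Suc n) = kendall_conv \<alpha> (\<mu> n) \<nu>" for n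
    unfolding \<mu>_def using assms by (intro distr_kendall_random_walk_Suc) auto
  have G_pow: "(\<integral>\<^sup>+x. ennreal (williamson \<alpha> t x) \<partial>\<mu> n) = ennreal (G ^ Suc n)" for n
  proof (induction n)
    case 0
    show ?case by (simp add: \<mu>_0 G)
  next
    case (Suc n)
    have "(\<integral>\<^sup>+x. ennreal (williamson \<alpha> t x) \<partial>\<mu> (Suc n)) = ennreal (G ^ Suc n) * ennreal G"
      unfolding \<mu>_Suc nn_integral_williamson_kendall_conv[OF assms(1,2) \<mu>(1) \<nu>(1) \<mu>(2) \<nu>(2)] G Suc ..
    then show ?case using nonneg by (simp add: ennreal_mult ac_simps)
  qed
  have "emeasure (\<mu> n) {..t} = ennreal (G ^ Suc n + real (Suc n) * G ^ n * h)" for n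
  proof (induction n)
    case 0
    \<comment> \<open>For nonnegative \<open>x\<close> the indicator of \<open>{..t}\<close> is the
      transform function plus the scaled power cut off at \<open>t\<close>, whence F_1 = G +
      h.\<close>
    have "emeasure \<nu> {..t} = (\<integral>\<^sup>+x. ennreal (williamson \<alpha> t x)
        + ennreal (x powr \<alpha> / t powr \<alpha>) * indicator {..t} x \<partial>\<nu>)"
    proof -
      have "(\<integral>\<^sup>+x. indicator {..t} x \<partial>\<nu>) = (\<integral>\<^sup>+x. ennreal (williamson \<alpha> t x)
          + ennreal (x powr \<alpha> / t powr \<alpha>) * indicator {..t} x \<partial>\<nu>)"
        using \<nu>(2)
      proof (intro nn_integral_cong_AE, eventually_elim)
        fix x :: real assume "0 \<le> x"
        then show "indicator {..t} x = ennreal (williamson \<alpha> t x)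
            + ennreal (x powr \<alpha> / t powr \<alpha>) * indicator {..t} x"
          using powr_divide_le_1[of \<alpha> x t] less_powr_divide[of \<alpha> t x] assms
          by (cases "x \<le> t") (simp_all add: williamson_def max_def flip: ennreal_plus)
      qed
      then show ?thesis by simp
    qed
    also have "\<dots> = ennreal G + ennreal h"
      by (simp add: nn_integral_add G h)
    finally show ?case using nonneg by (simp add: \<mu>_0)
  next
    case (Suc n)
    have "emeasure (\<mu> (Suc n)) {..t}
        = ennreal (G ^ Suc n + real (Suc n) * G ^ n * h) * ennreal G + ennreal (G ^ Suc n) * ennreal h"
      unfolding \<mu>_Suc emeasure_kendall_conv_atMost[OF assms(1,2) \<mu>(1) \<nu>(1) \<mu>(2) \<nu>(2)] G h Suc G_pow ..
    also have "\<dots> = ennreal ((G ^ Suc n + real (Suc n) * G ^ n * h) * G + G ^ Suc n * h)"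
      using nonneg by (simp add: ennreal_mult)
    also have "(G ^ Suc n + real (Suc n) * G ^ n * h) * G + G ^ Suc n * h
        = G ^ Suc (Suc n) + real (Suc (Suc n)) * G ^ Suc n * h"
      by (simp add: algebra_simps)
    finally show ?case .
  qed
  moreover have "emeasure (\<mu> n) {..t} = emeasure M {\<omega>\<in>space M. S (Suc n) \<omega> \<le> t}"
    unfolding \<mu>_def by (subst emeasure_distr) (auto intro!: arg_cong[where f = "emeasure M"])
  ultimately show ?thesis by (simp add: G_def h_def)
qed

text \<open>The free weights give both moments at once: constant 1 for the first,
  \<open>2n + 1\<close> for the second. All terms are nonnegative, so sum and integral may be
  exchanged.\<close>

lemma nn_integral_renewal_process:
  fixes w :: "nat \<Rightarrow> real"
  assumes "\<alpha> > 0" "t > 0" "\<nu> \<in> half_line_distributions" "kendall_random_walk \<alpha> \<nu> M S"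
    and "\<And>n. 0 \<le> w n"
    and sums: "(\<lambda>n. w n * (kendall_G \<alpha> \<nu> t ^ Suc n
        + real (Suc n) * kendall_G \<alpha> \<nu> t ^ n * (kendall_H \<alpha> \<nu> t / t powr \<alpha>))) sums s"
  shows "(\<integral>\<^sup>+\<omega>. (\<Sum>n. ennreal (w n) * of_bool (enat n < renewal_process S t \<omega>)) \<partial>M) = ennreal s"
proof -
  let ?p = "\<lambda>n. kendall_G \<alpha> \<nu> t ^ Suc n
      + real (Suc n) * kendall_G \<alpha> \<nu> t ^ n * (kendall_H \<alpha> \<nu> t / t powr \<alpha>)"
  have p: "0 \<le> ?p n" for n
    using kendall_G_nonneg[OF assms(1-3)] kendall_H_nonneg[OF assms(1-3)] by simp
  have S [measurable]: "S (Suc n) \<in> borel_measurable M" for n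
    using assms(4) by (simp add: kendall_random_walk_def)
  \<comment> \<open>The exceptional sets of the countably many steps are united into one null set.
    Outside it, S_(n+1) \<le> t passes backwards to every earlier position, so the event N(t) > n
    depends on the last position alone.\<close>
  have "AE \<omega> in M. \<forall>k. S (Suc (Suc k)) \<omega> \<le> t \<longrightarrow> S (Suc k) \<omega> \<le> t"
    unfolding AE_all_countable using kendall_random_walk_AE_mono[OF assms(1-4)] by simp
  then have AE: "AE \<omega> in M. enat n < renewal_process S t \<omega> \<longleftrightarrow> S (Suc n) \<omega> \<le> t" for n
  proof eventually_elim
    fix \<omega> assume *: "\<forall>k. S (Suc (Suc k)) \<omega> \<le> t \<longrightarrow> S (Suc k) \<omega> \<le> t"
    have "S (Suc k) \<omega> \<le> t" if "k \<le> n" "S (Suc n) \<omega> \<le> t" for k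
      using that by (induction rule: inc_induct) (use * in auto)
    then show "enat n < renewal_process S t \<omega> \<longleftrightarrow> S (Suc n) \<omega> \<le> t"
      by (auto simp: less_renewal_process_iff)
  qed
  have "(\<integral>\<^sup>+\<omega>. (\<Sum>n. ennreal (w n) * of_bool (enat n < renewal_process S t \<omega>)) \<partial>M)
      = (\<Sum>n. \<integral>\<^sup>+\<omega>. ennreal (w n) * of_bool (enat n < renewal_process S t \<omega>) \<partial>M)"
    unfolding less_renewal_process_iff by (intro nn_integral_suminf) measurable
  also have "\<dots> = (\<Sum>n. ennreal (w n * ?p n))"
  proof (intro suminf_cong)
    fix n
    have "(\<integral>\<^sup>+\<omega>. ennreal (w n) * of_bool (enat n < renewal_process S t \<omega>) \<partial>M)
        = (\<integral>\<^sup>+\<omega>. ennreal (w n) * indicator {\<omega>\<in>space M. S (Suc n) \<omega> \<le> t} \<omega> \<partial>M)"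
      using AE[of n] by (intro nn_integral_cong_AE) (auto elim!: eventually_mono simp: indicator_def)
    also have "\<dots> = ennreal (w n) * emeasure M {\<omega>\<in>space M. S (Suc n) \<omega> \<le> t}"
      by (intro nn_integral_cmult_indicator) measurable
    also have "\<dots> = ennreal (w n * ?p n)"
      unfolding emeasure_kendall_random_walk_le[OF assms(1-4)]
      by (rule ennreal_mult[symmetric, OF assms(5) p])
    finally show "(\<integral>\<^sup>+\<omega>. ennreal (w n) * of_bool (enat n < renewal_process S t \<omega>) \<partial>M)
      = ennreal (w n * ?p n)" .
  qed
  also have "\<dots> = ennreal s"
    using sums p assms(5) by (intro suminf_ennreal_eq) auto
  finally show ?thesis .
qed

theorem theorem2:
  fixes \<alpha> t :: real and \<nu> :: "real measure" and M :: "'a measure" and S :: "nat \<Rightarrow> 'a \<Rightarrow> real"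
  assumes "\<alpha> > 0"
    and "\<nu> \<in> half_line_distributions"
    and "\<nu> \<noteq> return borel 0"
    and "kendall_random_walk \<alpha> \<nu> M S"
    and "t > 0"
  shows "let G = kendall_G \<alpha> \<nu> t; G' = kendall_G_bar \<alpha> \<nu> t; H = kendall_H \<alpha> \<nu> t in
      renewal_function M S t = ereal (G / G' + H / (t powr \<alpha> * G'\<^sup>2)) \<and>
      renewal_second_moment M S t
        = ereal ((t powr (- \<alpha>) * H * (1 + 3 * G) + G * (1 - G\<^sup>2)) / G' ^ 3) \<and>
      renewal_variance M S t
        = H * (1 + G) / (t powr \<alpha> * G' ^ 3) + G / G'\<^sup>2 - H\<^sup>2 / (t powr (2 * \<alpha>) * G' ^ 4)"
proof -
  interpret M: prob_space M using assms(4) by (simp add: kendall_random_walk_def)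
  note hyps = assms(1,5,2,4)
  define G H h where "G = kendall_G \<alpha> \<nu> t" and "H = kendall_H \<alpha> \<nu> t" and "h = H / t powr \<alpha>"
  have G: "0 \<le> G" "G < 1"
    unfolding G_def using kendall_G_nonneg kendall_G_less_1 assms by auto
  have h: "0 \<le> h"
    unfolding h_def H_def using kendall_H_nonneg[OF hyps(1-3)] by simp
  define a b where "a = G / (1 - G) + h / (1 - G)\<^sup>2"
    and "b = (h * (1 + 3 * G) + G * (1 - G\<^sup>2)) / (1 - G) ^ 3"
  \<comment> \<open>Signs matter here: \<open>ennreal\<close> sends negative reals to 0, so an
    \<open>ennreal\<close> moment determines the real number \<open>a\<close> or \<open>b\<close>
    once that number is known to be nonnegative.\<close>
  have "G\<^sup>2 \<le> 1" using G by (simp add: power_le_one)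
  then have ab: "0 \<le> a" "0 \<le> b" using G h by (auto simp: a_def b_def)
  let ?N = "\<lambda>\<omega>. ennreal_of_enat (renewal_process S t \<omega>)"
  have [measurable]: "S (Suc n) \<in> borel_measurable M" for n
    using assms(4) by (simp add: kendall_random_walk_def)
  have [measurable]: "?N \<in> borel_measurable M"
    unfolding ennreal_of_enat_eq_suminf less_renewal_process_iff by measurable
  have 1: "(\<integral>\<^sup>+\<omega>. ?N \<omega> \<partial>M) = ennreal a"
    using nn_integral_renewal_process[OF hyps, of "\<lambda>_. 1" a] tail_sums(1)[OF G, of h]
    by (simp add: ennreal_of_enat_eq_suminf a_def G_def H_def h_def)
  have 2: "(\<integral>\<^sup>+\<omega>. (?N \<omega>)\<^sup>2 \<partial>M) = ennreal b"
    using nn_integral_renewal_process[OF hyps, of "\<lambda>n. real (2 * n + 1)" b] tail_sums(2)[OF G, of h]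
    unfolding ennreal_of_enat_power2_eq_suminf b_def G_def H_def h_def ennreal_of_nat_eq_real_of_nat
    by simp
  have "renewal_variance M S t = b - a\<^sup>2"
    unfolding renewal_variance_def by (rule M.variance_eq_ennreal_moments[OF _ 1 2 ab]) simp
  also have "\<dots> = h * (1 + G) / (1 - G) ^ 3 + G / (1 - G)\<^sup>2 - h\<^sup>2 / (1 - G) ^ 4"
  proof -
    \<comment> \<open>In terms of \<open>q\<close> every denominator is a power of one nonzero
      number, which leaves a polynomial identity. Its content: the cross term
      \<open>2 * G * h / q^3\<close> of \<open>a^2\<close> lowers \<open>1 + 3 * G\<close> to
      \<open>1 + G\<close>, and \<open>G * (1 - G^2) / q^3 - G^2 / q^2 = G / q^2\<close>.\<close>
    define q where "q = 1 - G"
    have q: "q \<noteq> 0" "G = 1 - q" using G by (auto simp: q_def)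
    show ?thesis
      unfolding a_def b_def q_def[symmetric] unfolding q(2)
      using q(1) by (simp add: divide_simps) algebra
  qed
  also have "h\<^sup>2 = H\<^sup>2 / t powr (2 * \<alpha>)"
    by (simp add: h_def power_divide power2_eq_square flip: powr_add)
  finally have "renewal_variance M S t
      = H * (1 + G) / (t powr \<alpha> * (1 - G) ^ 3) + G / (1 - G)\<^sup>2 - H\<^sup>2 / (t powr (2 * \<alpha>) * (1 - G) ^ 4)"
    by (simp add: h_def)
  moreover have "renewal_function M S t = ereal (G / (1 - G) + H / (t powr \<alpha> * (1 - G)\<^sup>2))"
    using ab by (simp add: renewal_function_def 1 a_def h_def)
  moreover have "renewal_second_moment M S t
      = ereal ((t powr (- \<alpha>) * H * (1 + 3 * G) + G * (1 - G\<^sup>2)) / (1 - G) ^ 3)"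
    using ab by (simp add: renewal_second_moment_def 2 b_def h_def powr_minus divide_inverse mult_ac)
  ultimately show ?thesis
    by (simp add: Let_def kendall_G_bar_def G_def H_def)
qed

end
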